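(* Let $C_L$ and $S$ be positive integers and let $W=1$. Let $T^{\max}$ be the worst sensor transmission, as defined in the context. (i) If $\gcd(C_L,W+S)=1$, then $T^{\max}$ exists and $T^{\max}=C_L-S$. (ii) If $\gcd(C_L,W+S)\neq 1$, then $T^{\max}$ does not exist.
   Context: Time is divided into slots. $C_L$ is the duty-cycle length of a sensor: a sensor first arriving at slot $n\in\{1,\dots,C_L\}$ transmits at slots $n+j\,C_L$, $j\in\mathbb{N}$. A gateway repeats a wakeup-sleep cycle of length $W+S$ that starts with $W=1$ wakeup slot followed by $S$ sleeping slots, so it is awake at slots $W+k(W+S)$, $k\in\mathbb{N}$. Here $\mathbb{N}=\{0,1,2,\dots\}$. For $n\in\{1,\dots,C_L\}$, if there exist $j,k\in\mathbb{N}$ with $n+j\,C_L=W+k(W+S)$, then $C_L^{\min}(n)$ (the minimum number of sensor duty-cycles) denotes the least such $j$, and $N_{sleep}^{\min}(n)$ (the minimum number of wakeup-sleep cycles) the corresponding $k$, which is also the least possible $k$. If no such $j,k$ exist, the sensor arriving at slot $n$ is never received (infinite waiting time) and $C_L^{\min}(n)$ is undefined. The worst sensor transmission is $$T^{\max}=\mathop{\arg\max}_{n=1,\dots,C_L}\bigl(n+C_L^{\min}(n)\,C_L\bigr),$$ the arrival slot whose reception slot is latest. It is said to exist if and only if $C_L^{\min}(n)$ is defined for every $n\in\{1,\dots,C_L\}$, i.e. every possible arrival is eventually received.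
   Formalization: The formula T^max = C_L − S is false when S ≥ C_L (e.g. C_L = S = 1 gives T^max = 1); it is proved for S < C_L, and for all S it is proved that T^max exists and is the element of {1,…,C_L} congruent to C_L − S modulo C_L. *)

theory Defs
  imports Main "HOL-Number_Theory.Cong"
begin

text \<open>
  Throughout, \<open>C\<close> is the duty-cycle length, \<open>W\<close> the number of wakeup slots and \<open>S\<close> the number of
  sleeping slots. The formula \<open>W + k * (W + S)\<close> for the awake slots describes the gateway
  for \<open>W = 1\<close> only.
\<close>

definition meets :: "nat \<Rightarrow> nat \<Rightarrow> nat \<Rightarrow> nat \<Rightarrow> nat \<Rightarrow> nat \<Rightarrow> bool" where
  "meets C W S n j k \<longleftrightarrow> n + j * C = W + k * (W + S)"

definition C_L_min :: "nat \<Rightarrow> nat \<Rightarrow> nat \<Rightarrow> nat \<Rightarrow> nat option" where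
  "C_L_min C W S n =
     (if \<exists>j k. meets C W S n j k then Some (LEAST j. \<exists>k. meets C W S n j k) else None)"

text \<open>Only meaningful if \<open>C_L_min C W S n\<close> is not \<open>None\<close>.\<close>

definition reception_slot :: "nat \<Rightarrow> nat \<Rightarrow> nat \<Rightarrow> nat \<Rightarrow> nat" where
  "reception_slot C W S n = n + the (C_L_min C W S n) * C"

text \<open>
  \<open>None\<close> means that the worst sensor transmission does not exist. For \<open>C > 0\<close>, distinct arrivals in
  \<open>{1..C}\<close> have reception slots in distinct residue classes modulo \<open>C\<close>, so the maximiser is unique
  and the choice hidden in \<open>ARG_MAX\<close> is immaterial.
\<close>

definition T_max :: "nat \<Rightarrow> nat \<Rightarrow> nat \<Rightarrow> nat option" where
  "T_max C W S =
     (if \<forall>n\<in>{1..C}. C_L_min C W S n \<noteq> None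
      then Some (ARG_MAX (reception_slot C W S) n. n \<in> {1..C})
      else None)"

end

theory Submission
  imports Defs
begin

text \<open>
  Every number \<open>\<ge> 1\<close> is uniquely \<open>n + j * C\<close> with \<open>n \<in> {1..C}\<close>, so the awake slot
  \<open>1 + k * (1 + S)\<close> serves exactly one arrival slot. If \<open>C\<close> and \<open>1 + S\<close> are coprime, the first
  \<open>C\<close> awake slots run through all residue classes modulo \<open>C\<close> once, hence each arrival is served
  by exactly one of them, and the worst arrival is the one served by the last,
  \<open>1 + (C - 1) * (1 + S) = C * (1 + S) - S\<close>, which is congruent to \<open>- S\<close>. If they share a
  divisor \<open>d > 1\<close>, arrival \<open>2\<close> is never served because \<open>d\<close> does not divide \<open>2 - 1\<close>.
\<close>

lemma cong_interval_imp_eq: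
  fixes m n C :: nat
  assumes "m \<in> {1..C}" "n \<in> {1..C}" "[m = n] (mod C)"
  shows "m = n"
proof -
  \<comment> \<open>Shifting by one turns \<open>{1..C}\<close> into the standard residues below
    \<open>C\<close>.\<close>
  have "[m - 1 = n - 1] (mod C)"
    using assms by (metis atLeastAtMost_iff cong_add_rcancel_nat le_add_diff_inverse2)
  then have "m - 1 = n - 1"
    using assms by (intro cong_less_modulus_unique_nat[of _ _ C]) auto
  then show ?thesis
    using assms by auto
qed

lemma cong_imp_shift:
  fixes m n C :: nat
  assumes "n \<in> {1..C}" "m \<ge> 1" "[m = n] (mod C)"
  obtains j where "n + j * C = m"
proof (cases "n \<le> m")
  case True
  with assms(3) obtain j where "m = n + j * C"
    by (metis cong_le_nat add.commute)
  then show ?thesis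
    by (intro that[of j]) simp
next
  \<comment> \<open>Here \<open>m < n\<close>, so \<open>m\<close> lies in \<open>{1..C}\<close> as
    well. The bound \<open>m \<ge> 1\<close> excludes \<open>m = 0\<close>, which is congruent to
    \<open>n = C\<close> but below it.\<close>
  case False
  then have "m = n"
    using assms by (intro cong_interval_imp_eq[of _ C]) auto
  with that[of 0] show ?thesis
    by simp
qed

lemma meets_imp_reception_slot:
  assumes "meets C W S n j k"
  obtains j' k' where "C_L_min C W S n = Some j'" "meets C W S n j' k'"
    "reception_slot C W S n = W + k' * (W + S)" "j' \<le> j"
proof -
  define l where "l = (LEAST j. \<exists>k. meets C W S n j k)"
  have "\<exists>k. meets C W S n l k"
    unfolding l_def by (rule LeastI_ex) (use assms in blast)
  then obtain k' where k': "meets C W S n l k'"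
    by blast
  have l: "C_L_min C W S n = Some l"
    using assms by (auto simp: C_L_min_def l_def)
  have "l \<le> j"
    unfolding l_def by (rule Least_le) (use assms in blast)
  with k' l show ?thesis
    using that by (auto simp: reception_slot_def meets_def)
qed

lemma coprime_meets_early:
  assumes "coprime C (1 + S)" "n \<in> {1..C}"
  obtains j k where "meets C 1 S n j k" "k < C"
proof -
  have "C > 0"
    using assms(2) by auto
  obtain x where x: "[(1 + S) * x = 1] (mod C)"
    using assms(1) cong_solve_coprime_nat coprime_commute by (metis One_nat_def)
  \<comment> \<open>The solution of \<open>1 + k * (1 + S) = n\<close> modulo \<open>C\<close>,
    using the inverse \<open>x\<close> of \<open>1 + S\<close>; reducing it gives
    \<open>k < C\<close>.\<close>
  define k where "k = (x * (n - 1)) mod C"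
  have "[k * (1 + S) = x * (n - 1) * (1 + S)] (mod C)"
    unfolding k_def by (intro cong_mult cong_refl) simp
  also have "x * (n - 1) * (1 + S) = ((1 + S) * x) * (n - 1)"
    by (simp only: ac_simps)
  also have "[\<dots> = 1 * (n - 1)] (mod C)"
    by (intro cong_mult cong_refl x)
  finally have "[1 + k * (1 + S) = 1 + 1 * (n - 1)] (mod C)"
    by (intro cong_add cong_refl)
  then have "[1 + k * (1 + S) = n] (mod C)"
    using assms(2) by simp
  then obtain j where "n + j * C = 1 + k * (1 + S)"
    using cong_imp_shift[OF assms(2)] by (metis le_add1)
  moreover have "k < C"
    using \<open>C > 0\<close> by (simp add: k_def)
  ultimately show ?thesis
    using that by (simp add: meets_def)
qed

lemma reception_slot_le:
  assumes "coprime C (1 + S)" "n \<in> {1..C}"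
  shows "reception_slot C 1 S n \<le> 1 + (C - 1) * (1 + S)"
proof -
  obtain j k where jk: "meets C 1 S n j k" "k < C"
    using coprime_meets_early[OF assms] .
  obtain j' k' where "C_L_min C 1 S n = Some j'" "j' \<le> j"
    using meets_imp_reception_slot[OF jk(1)] by blast
  then have "reception_slot C 1 S n \<le> n + j * C"
    by (simp add: reception_slot_def)
  also have "\<dots> = 1 + k * (1 + S)"
    using jk(1) by (simp add: meets_def)
  also have "\<dots> \<le> 1 + (C - 1) * (1 + S)"
    using jk(2) by (intro add_left_mono mult_right_mono) auto
  finally show ?thesis .
qed

text \<open>The least meeting might come before awake slot \<open>C - 1\<close>. But awake slots
  that serve the same arrival agree modulo \<open>C\<close>, and cancelling \<open>1 + S\<close>
  shows that their indices do too, so no smaller index is possible.\<close>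

lemma reception_slot_eq_last:
  assumes "coprime C (1 + S)" "C > 0" and meets: "meets C 1 S n j (C - 1)"
  shows "reception_slot C 1 S n = 1 + (C - 1) * (1 + S)"
proof -
  obtain j' k' where m: "meets C 1 S n j' k'" and
      r: "reception_slot C 1 S n = 1 + k' * (1 + S)" and "j' \<le> j"
    using meets_imp_reception_slot[OF meets] by metis
  have "1 + k' * (1 + S) \<le> 1 + (C - 1) * (1 + S)"
    using m meets \<open>j' \<le> j\<close> unfolding meets_def by (metis add_left_mono mult_le_mono1)
  then have "k' \<le> C - 1"
    by (metis add_le_cancel_left mult_le_cancel2 zero_less_Suc plus_1_eq_Suc)
  have "[1 + k' * (1 + S) = 1 + (C - 1) * (1 + S)] (mod C)"
    using m meets unfolding meets_def by (metis cong_def mod_mult_self1)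
  then have "[k' * (1 + S) = (C - 1) * (1 + S)] (mod C)"
    using cong_add_lcancel_nat by blast
  then have "[k' = C - 1] (mod C)"
    using assms(1) cong_mult_rcancel_nat coprime_commute by blast
  then have "k' = C - 1"
    using \<open>k' \<le> C - 1\<close> \<open>C > 0\<close> by (intro cong_less_modulus_unique_nat[of _ _ C]) auto
  with r show ?thesis
    by simp
qed

lemma T_max_coprime:
  assumes "coprime C (1 + S)" "T \<in> {1..C}" "meets C 1 S T j (C - 1)"
  shows "T_max C 1 S = Some T"
proof -
  let ?r = "reception_slot C 1 S"
  have defined: "C_L_min C 1 S n \<noteq> None" if "n \<in> {1..C}" for n
    by (rule coprime_meets_early[OF assms(1) that]) (auto simp: C_L_min_def)
  have rT: "?r T = 1 + (C - 1) * (1 + S)"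
    using assms by (intro reception_slot_eq_last) auto
  have "(ARG_MAX ?r n. n \<in> {1..C}) = T"
  proof (rule arg_maxI)
    fix n assume "n \<in> {1..C}"
    then show "\<not> ?r n > ?r T"
      using reception_slot_le[OF assms(1)] rT by (metis not_less)
  next
    \<comment> \<open>Uniqueness of the maximiser: another one would share its reception slot with
      \<open>T\<close>, hence its residue modulo \<open>C\<close>.\<close>
    fix n assume n: "n \<in> {1..C}" and max: "\<forall>y. y \<in> {1..C} \<longrightarrow> \<not> ?r n < ?r y"
    then have "?r n = ?r T"
      using reception_slot_le[OF assms(1) n] rT assms(2) by (metis le_antisym not_less)
    then have "[n = T] (mod C)"
      unfolding reception_slot_def by (metis cong_def mod_mult_self1)
    with n assms(2) show "n = T"
      by (rule cong_interval_imp_eq)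
  qed (fact assms(2))
  with defined show ?thesis
    by (simp add: T_max_def)
qed

lemma T_max_not_coprime:
  assumes "C > 0" "\<not> coprime C (1 + S)"
  shows "T_max C 1 S = None"
proof -
  define d where "d = gcd C (1 + S)"
  have d: "d dvd C" "d dvd 1 + S" "d \<noteq> 1"
    using assms(2) by (auto simp: d_def coprime_iff_gcd_eq_1)
  \<comment> \<open>This makes \<open>2\<close> an arrival slot; \<open>C = 1\<close> would force
    \<open>d = 1\<close>.\<close>
  have "C \<ge> 2"
    using d assms(1) by (cases "C = 1") auto
  have "\<not> meets C 1 S 2 j k" for j k
  proof
    assume "meets C 1 S 2 j k"
    then have "1 + j * C = k * (1 + S)"
      by (simp add: meets_def)
    then have "d dvd 1"
      using d by (metis dvd_add_left_iff dvd_mult)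
    with d show False
      by simp
  qed
  then have "C_L_min C 1 S 2 = None"
    by (simp add: C_L_min_def)
  with \<open>C \<ge> 2\<close> show ?thesis
    by (force simp: T_max_def)
qed

text \<open>For \<open>S \<ge> C_L\<close> the integer \<open>C_L - S\<close> is not an arrival
  slot, so the formula is then read modulo \<open>C_L\<close>; together with the range
  \<open>{1..C_L}\<close> this still determines \<open>T\<close>. Working in \<open>int\<close>
  avoids truncated subtraction.\<close>

theorem theorem1:
  fixes C_L W S :: nat
  assumes "C_L > 0" and "S > 0" and "W = 1"
  shows "(gcd C_L (W + S) = 1 \<longrightarrow>
            (\<exists>T. T_max C_L W S = Some T \<and>
                 (S < C_L \<longrightarrow> int T = int C_L - int S) \<and>
                 T \<in> {1..C_L} \<and> [int T = int C_L - int S] (mod int C_L))) \<and>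
         (gcd C_L (W + S) \<noteq> 1 \<longrightarrow> T_max C_L W S = None)"
proof (intro conjI impI)
  assume "gcd C_L (W + S) = 1"
  then have cop: "coprime C_L (1 + S)"
    using assms by (simp add: coprime_iff_gcd_eq_1)
  \<comment> \<open>Division of the last relevant awake slot by \<open>C_L\<close>, with remainders
    taken in \<open>{1..C_L}\<close> instead of from \<open>0\<close>.\<close>
  define q where "q = ((C_L - 1) * (1 + S)) div C_L"
  define T where "T = 1 + ((C_L - 1) * (1 + S)) mod C_L"
  have T: "T \<in> {1..C_L}"
    using assms by (simp add: T_def Suc_le_eq)
  have eq: "T + q * C_L = 1 + (C_L - 1) * (1 + S)"
    by (simp add: T_def q_def)
  have "int T + int q * int C_L = 1 + int (C_L - 1) * (1 + int S)"
    using arg_cong[OF eq, of int] by (simp only: of_nat_add of_nat_mult of_nat_1)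
  also have "int (C_L - 1) = int C_L - 1"
    using assms(1) by (simp add: of_nat_diff)
  finally have "int T + int q * int C_L = 1 + (int C_L - 1) * (1 + int S)" .
  \<comment> \<open>The right-hand side above expands to \<open>C_L + C_L * S - S\<close>.\<close>
  then have "int T - (int C_L - int S) = int C_L * (int S - int q)"
    by (simp add: algebra_simps)
  then have cong: "[int T = int C_L - int S] (mod int C_L)"
    by (simp add: cong_iff_dvd_diff)
  have "int T = int C_L - int S" if "S < C_L"
  proof -
    have "[T = C_L - S] (mod C_L)"
      using cong that by (simp add: of_nat_diff flip: cong_int_iff)
    then have "T = C_L - S"
      using T that assms(2) by (intro cong_interval_imp_eq[of _ C_L]) auto
    then show ?thesis
      using that by simp
  qed
  moreover have "T_max C_L W S = Some T"
    using T_max_coprime[OF cop T] eq assms(3) by (simp add: meets_def)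
  ultimately show "\<exists>T. T_max C_L W S = Some T \<and>
      (S < C_L \<longrightarrow> int T = int C_L - int S) \<and>
      T \<in> {1..C_L} \<and> [int T = int C_L - int S] (mod int C_L)"
    using T cong by blast
next
  assume "gcd C_L (W + S) \<noteq> 1"
  then show "T_max C_L W S = None"
    using assms T_max_not_coprime by (simp add: coprime_iff_gcd_eq_1)
qed

end
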